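(* Let $m:\{n\in\mathbb{N}: n\ge 4\}\to\mathbb{N}$ be any function such that $2\le m(n)\le \frac{n}{2}$ for all $n\ge 4$ and $m(n)=o(n)$ as $n\to\infty$. For natural numbers $n,m$ with $m\ge 2$ put $q(n,m)=\left\lfloor \frac{n}{2m}\right\rfloor$ and $$A(n,m)=\sum_{i=0}^{2q(n,m)}\binom{n^m}{i}.$$ Then for every $n\ge 4$ and every $n$-uniform clique $H=(V,E)$ with $\chi(H)=3$ and $|V|\le n^{m(n)}$, one has $$|E|\le 4\,m(n)\,n^{n-1}+A(n,m(n)),$$ and moreover, as $n\to\infty$, $$4\,m(n)\,n^{n-1}+A(n,m(n))=(4+o(1))\,m(n)\,n^{n-1}.$$
   Context: A hypergraph $H=(V,E)$ consists of a vertex set $V$ and a set $E$ of subsets of $V$ called edges (no multiple edges). It is $n$-uniform if $|e|=n$ for every $e\in E$. The chromatic number $\chi(H)$ is the minimum number of colors needed to color all vertices in $V$ so that every edge $e\in E$ contains at least two vertices of different colors. A hypergraph is a clique if its edges are pairwise intersecting, i.e. $e\cap e'\neq\emptyset$ for all $e,e'\in E$. The symbol $o(1)$ denotes a quantity (depending on $n$ and on the function $m$) that tends to $0$ as $n\to\infty$. *)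

theory Defs
  imports Complex_Main "HOL-Library.FuncSet" "HOL-Library.Extended_Nat" "HOL-Library.Landau_Symbols"
begin

definition hypergraph :: "'a set \<Rightarrow> 'a set set \<Rightarrow> bool" where
  "hypergraph V E \<longleftrightarrow> (\<forall>e\<in>E. e \<subseteq> V)"

text \<open>Finiteness is required explicitly because \<open>card\<close> of an infinite set is \<open>0\<close>.\<close>

definition uniform :: "nat \<Rightarrow> 'a set set \<Rightarrow> bool" where
  "uniform n E \<longleftrightarrow> (\<forall>e\<in>E. finite e \<and> card e = n)"

definition clique :: "'a set set \<Rightarrow> bool" where
  "clique E \<longleftrightarrow> (\<forall>e\<in>E. \<forall>e'\<in>E. e \<inter> e' \<noteq> {})"

definition proper_coloring :: "'a set \<Rightarrow> 'a set set \<Rightarrow> nat \<Rightarrow> ('a \<Rightarrow> nat) \<Rightarrow> bool" where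
  "proper_coloring V E k c \<longleftrightarrow>
     c \<in> V \<rightarrow> {..<k} \<and> (\<forall>e\<in>E. \<exists>x\<in>e. \<exists>y\<in>e. c x \<noteq> c y)"

text \<open>The value is \<open>\<infinity>\<close> if no finite number of colors suffices.\<close>

definition chromatic_number :: "'a set \<Rightarrow> 'a set set \<Rightarrow> enat" where
  "chromatic_number V E = Inf {enat k | k. \<exists>c. proper_coloring V E k c}"

definition q :: "nat \<Rightarrow> nat \<Rightarrow> nat" where
  "q n m = nat \<lfloor>real n / (2 * real m)\<rfloor>"

definition A :: "nat \<Rightarrow> nat \<Rightarrow> nat" where
  "A n m = (\<Sum>i = 0..2 * q n m. (n ^ m) choose i)"

end

theory Submission
  imports Defs "HOL-Library.Function_Algebras"
begin

text \<open>
  Write \<open>deg S\<close> for the number of edges containing \<open>S\<close>. In a clique with chromatic number 3 no set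
  of fewer than \<open>n\<close> vertices meets every edge, so branching over an edge disjoint from \<open>S\<close> gives
  \<open>deg S \<le> n ^ (n - card S)\<close>. Branching over two edges \<open>e, e'\<close> disjoint from \<open>S\<close> improves this by a
  factor \<open>1 - y (1 - y)\<close> with \<open>y = 1 / (2 m)\<close>, provided that \<open>q < card (e \<inter> e') < n - q\<close>. By the
  Frankl-Wilson theorem for the intersection sizes \<open>{1..q} \<union> {n - q..<n}\<close>, such a pair exists among
  any more than \<open>A n m\<close> edges.

  Suppose that more than \<open>4 m n ^ (n - 1) + A n m\<close> edges exist, and let \<open>x n ^ (n - 1)\<close> be the maximal
  vertex degree. Then the pairs are available for every \<open>S\<close> of size at most \<open>4 m / x\<close>, and iterating the
  improvement from a vertex of maximal degree gives roughly \<open>x \<le> exp (- 1 / x)\<close>, which no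
  \<open>x \<in> {0<..1}\<close> satisfies.
\<close>

section \<open>The Frankl-Wilson bound by the polynomial method\<close>

lemma card_small_subsets:
  assumes "finite V"
  shows "card {S. S \<subseteq> V \<and> card S \<le> k} = (\<Sum>i = 0..k. card V choose i)"
proof -
  have "{S. S \<subseteq> V \<and> card S \<le> k} = (\<Union>i\<in>{0..k}. {S. S \<subseteq> V \<and> card S = i})"
    by auto
  also have "card \<dots> = (\<Sum>i = 0..k. card {S. S \<subseteq> V \<and> card S = i})"
    using assms by (intro card_UN_disjoint) auto
  also have "\<dots> = (\<Sum>i = 0..k. card V choose i)"
    using assms by (simp add: n_subsets)
  finally show ?thesis .
qed

text \<open>Each \<open>f\<close> in \<open>F\<close> yields the function \<open>P L f\<close> that
  sends \<open>x\<close> to the product of the \<open>card (x \<inter> f) - l\<close> over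
  \<open>l\<close> in \<open>L\<close>. On \<open>F\<close> these functions vanish exactly off the
  diagonal, so they are linearly independent; they lie in the span of the monomials of degree at
  most \<open>card L\<close>, which the right-hand side counts.\<close>

theorem frankl_wilson:
  assumes V: "finite V" and F: "F \<subseteq> Pow V" and L: "finite L"
    and diag: "\<And>e. e \<in> F \<Longrightarrow> card e \<notin> L"
    and off_diag: "\<And>e f. e \<in> F \<Longrightarrow> f \<in> F \<Longrightarrow> e \<noteq> f \<Longrightarrow> card (e \<inter> f) \<in> L"
  shows "card F \<le> (\<Sum>i = 0..card L. card V choose i)"
proof -
  interpret fs: vector_space "\<lambda>(c::real) (f::'a set \<Rightarrow> real) x. c * f x"
    by unfold_locales (auto simp: algebra_simps fun_eq_iff)
  \<comment> \<open>\<open>chi S\<close> is the multilinear monomial with variable set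
    \<open>S\<close>, evaluated at the indicator vector of \<open>x\<close>. Since 0/1 coordinates
    are idempotent, products of such monomials are again of this form.\<close>
  define chi :: "'a set \<Rightarrow> 'a set \<Rightarrow> real" where "chi S x = of_bool (S \<subseteq> x)" for S x
  define W where "W k = fs.span (chi ` {S. S \<subseteq> V \<and> card S \<le> k})" for k
  define P :: "nat set \<Rightarrow> 'a set \<Rightarrow> 'a set \<Rightarrow> real"
    where "P M f x = (\<Prod>l\<in>M. real (card (x \<inter> f)) - real l)" for M f x
  have sum_apply: "(\<Sum>v\<in>T. h v) x = (\<Sum>v\<in>T. h v x)"
    for T :: "'b set" and h :: "'b \<Rightarrow> 'a set \<Rightarrow> real" and x
    by (induction T rule: infinite_finite_induct) auto
  \<comment> \<open>A linear factor raises the degree by at most one: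
    \<open>card (x \<inter> f)\<close> is the sum of the coordinates of \<open>x\<close> over
    \<open>f\<close>, and multiplying \<open>chi S\<close> by the coordinate of \<open>v\<close>
    gives \<open>chi (insert v S)\<close>.\<close>
  have mult_linear: "(\<lambda>x. (real (card (x \<inter> f)) - real l) * p x) \<in> W (Suc k)"
    if f: "f \<subseteq> V" and p: "p \<in> W k" for f l p k
    using p unfolding W_def
  proof (induction rule: fs.span_induct_alt)
    case base
    have "(\<lambda>x. (real (card (x \<inter> f)) - real l) * 0 x) = (0 :: 'a set \<Rightarrow> real)"
      by (simp add: fun_eq_iff)
    then show ?case by (simp only: fs.span_zero)
  next
    case (step c p y)
    then obtain S where S: "p = chi S" "S \<subseteq> V" "card S \<le> k"
      by auto
    have fin: "finite f" using f V by (rule finite_subset)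
    have "real (card (x \<inter> f)) = (\<Sum>v\<in>f. of_bool (v \<in> x))" for x
    proof -
      have "real (card (x \<inter> f)) = (\<Sum>v\<in>x \<inter> f. 1)" by simp
      also have "\<dots> = (\<Sum>v\<in>f. of_bool (v \<in> x))"
        using fin by (intro sum.mono_neutral_cong_left) auto
      finally show ?thesis .
    qed
    then have "real (card (x \<inter> f)) * chi S x = (\<Sum>v\<in>f. chi (insert v S) x)" for x
      by (simp add: chi_def sum_distrib_right flip: of_bool_conj)
    then have eq: "(\<lambda>x. (real (card (x \<inter> f)) - real l) * ((\<lambda>x. c * p x) + y) x)
        = (\<lambda>x. c * (\<Sum>v\<in>f. chi (insert v S)) x) + (\<lambda>x. (- c * real l) * chi S x)
          + (\<lambda>x. (real (card (x \<inter> f)) - real l) * y x)"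
      by (simp add: fun_eq_iff S algebra_simps sum_apply)
    have "chi (insert v S) \<in> W (Suc k)" if "v \<in> f" for v
      unfolding W_def using that f S V
      by (intro fs.span_base imageI) (auto intro: order.trans[OF card_insert_le_m1] simp: card_insert_if finite_subset)
    then have "(\<Sum>v\<in>f. chi (insert v S)) \<in> W (Suc k)"
      unfolding W_def by (intro fs.span_sum) auto
    moreover have "chi S \<in> W (Suc k)"
      unfolding W_def using S by (intro fs.span_base imageI) auto
    ultimately show ?case
      unfolding eq using step.IH unfolding W_def by (intro fs.span_add fs.span_scale)
  qed
  have P_W: "P M f \<in> W (card M)" if "f \<subseteq> V" "finite M" for f M
    using that(2)
  proof induction
    case empty
    have "P {} f = chi {}" by (auto simp: P_def chi_def)
    then show ?case unfolding W_def by (auto intro!: fs.span_base imageI)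
  next
    case (insert l M)
    have "P (insert l M) f = (\<lambda>x. (real (card (x \<inter> f)) - real l) * P M f x)"
      using insert.hyps by (simp add: P_def fun_eq_iff)
    then show ?case
      using mult_linear[OF that(1) insert.IH] insert by simp
  qed
  have P_diag: "P L f f \<noteq> 0" if "f \<in> F" for f
    using diag[OF that] L by (auto simp: P_def)
  have P_off: "P L f g = 0" if "f \<in> F" "g \<in> F" "f \<noteq> g" for f g
    using off_diag[of g f] that L by (auto simp: P_def)
  have inj: "inj_on (P L) F"
    using P_diag P_off by (intro inj_onI) metis
  have finF: "finite F" using F V by (meson finite_Pow_iff finite_subset)
  have indep: "fs.independent (P L ` F)"
    unfolding fs.independent_explicit_finite_subsets
  proof (intro allI impI ballI)
    fix T u v
    assume T: "T \<subseteq> P L ` F" "finite T" and z: "(\<Sum>v\<in>T. (\<lambda>x. u v * v x)) = 0" and v: "v \<in> T"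
    obtain f where f: "f \<in> F" "v = P L f" using T v by auto
    \<comment> \<open>Evaluation at \<open>f\<close> kills every term except the one of
      \<open>P L f\<close>.\<close>
    have "0 = (\<Sum>w\<in>T. (\<lambda>x. u w * w x)) f" using z by simp
    also have "\<dots> = (\<Sum>w\<in>T. u w * w f)" by (simp add: sum_apply)
    also have "\<dots> = (\<Sum>w\<in>{v}. u w * w f)"
      using T v f P_off by (intro sum.mono_neutral_right) fastforce+
    finally show "u v = 0" using P_diag f by simp
  qed
  have "P L ` F \<subseteq> fs.span (chi ` {S. S \<subseteq> V \<and> card S \<le> card L})"
    using P_W L F unfolding W_def by blast
  moreover have fin: "finite {S. S \<subseteq> V \<and> card S \<le> card L}" using V by simp
  ultimately have "card (P L ` F) \<le> card (chi ` {S. S \<subseteq> V \<and> card S \<le> card L})"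
    using fs.independent_span_bound[OF _ indep] by blast
  also have "\<dots> \<le> card {S. S \<subseteq> V \<and> card S \<le> card L}"
    by (rule card_image_le[OF fin])
  finally show ?thesis
    by (simp add: card_image[OF inj] card_small_subsets[OF V])
qed

section \<open>Rounding in \<open>q\<close>\<close>

lemma q_bounds:
  assumes "m > 0"
  shows "2 * m * q n m \<le> n" and "real n < 2 * real m * (real (q n m) + 1)"
proof -
  define r where "r = real n / (2 * real m)"
  have "r \<ge> 0" by (simp add: r_def)
  then have "real (q n m) \<le> r" "r < real (q n m) + 1"
    unfolding q_def r_def[symmetric] by linarith+
  then have "2 * real m * real (q n m) \<le> real n" "real n < 2 * real m * (real (q n m) + 1)"
    using assms by (simp_all add: r_def field_simps)
  then show "2 * m * q n m \<le> n" "real n < 2 * real m * (real (q n m) + 1)"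
    by (simp_all flip: of_nat_le_iff[where ?'a = real])
qed

section \<open>Degrees of vertex sets in cliques of chromatic number 3\<close>

definition degree :: "'a set set \<Rightarrow> 'a set \<Rightarrow> nat" where
  "degree E S = card {f \<in> E. S \<subseteq> f}"

text \<open>The branching principle: \<open>T\<close> will list extensions of \<open>S\<close> by
  vertices of one or two edges that every edge has to meet.\<close>

lemma degree_le_sum:
  assumes "finite E" "finite I" and "\<And>f. f \<in> E \<Longrightarrow> S \<subseteq> f \<Longrightarrow> \<exists>i\<in>I. T i \<subseteq> f"
  shows "degree E S \<le> (\<Sum>i\<in>I. degree E (T i))"
proof -
  have "{f \<in> E. S \<subseteq> f} \<subseteq> (\<Union>i\<in>I. {f \<in> E. T i \<subseteq> f})"
    using assms(3) by auto
  then have "degree E S \<le> card (\<Union>i\<in>I. {f \<in> E. T i \<subseteq> f})"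
    unfolding degree_def using assms(1,2) by (intro card_mono) auto
  also have "\<dots> \<le> (\<Sum>i\<in>I. degree E (T i))"
    unfolding degree_def by (rule card_UN_le[OF assms(2)])
  finally show ?thesis .
qed

locale three_chromatic_clique =
  fixes V :: "'a set" and E :: "'a set set" and n :: nat
  assumes finV: "finite V" and hyp: "hypergraph V E" and unif: "uniform n E"
    and cli: "clique E" and chrom: "chromatic_number V E = 3" and n_pos: "n > 0"
begin

lemma finE: "finite E"
  using finV hyp unfolding hypergraph_def by (meson Pow_iff finite_Pow_iff finite_subset subsetI)

lemma edge_finite: "e \<in> E \<Longrightarrow> finite e"
  and edge_card: "e \<in> E \<Longrightarrow> card e = n"
  and edge_subset: "e \<in> E \<Longrightarrow> e \<subseteq> V"
  using unif hyp by (auto simp: uniform_def hypergraph_def)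

lemma edges_meet: "e \<in> E \<Longrightarrow> f \<in> E \<Longrightarrow> \<exists>v\<in>e. v \<in> f"
  using cli by (auto simp: clique_def)

text \<open>Such an \<open>S\<close> is too small to contain an edge. If it met every edge,
  colouring \<open>S\<close> against its complement would be a proper 2-colouring.\<close>

lemma ex_disjoint_edge:
  assumes "finite S" "card S < n"
  shows "\<exists>e\<in>E. e \<inter> S = {}"
proof (rule ccontr)
  assume no: "\<not> ?thesis"
  define c :: "'a \<Rightarrow> nat" where "c x = of_bool (x \<in> S)" for x
  have "\<exists>x\<in>e. \<exists>y\<in>e. c x \<noteq> c y" if e: "e \<in> E" for e
  proof -
    obtain x where x: "x \<in> e" "x \<in> S" using no e by auto
    have "\<not> e \<subseteq> S"
      using card_mono[OF assms(1), of e] edge_card[OF e] assms(2) by linarith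
    then obtain y where "y \<in> e" "y \<notin> S" by auto
    with x show ?thesis by (auto simp: c_def)
  qed
  then have "proper_coloring V E 2 c"
    by (auto simp: proper_coloring_def c_def)
  then have "chromatic_number V E \<le> enat 2"
    unfolding chromatic_number_def by (intro Inf_lower) auto
  then have "(3 :: enat) \<le> 2" unfolding chrom by (simp only: numeral_eq_enat)
  then show False by simp
qed

text \<open>Each branching over an edge disjoint from \<open>S\<close> costs a factor
  \<open>n\<close> and adds one vertex to \<open>S\<close>. A set of \<open>n\<close> vertices lies
  in no edge other than itself.\<close>

lemma degree_le:
  assumes "finite S" "card S \<le> n"
  shows "degree E S \<le> n ^ (n - card S)"
  using assms
proof (induction "n - card S" arbitrary: S)
  case 0
  have "{f \<in> E. S \<subseteq> f} \<subseteq> {S}"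
  proof (rule subsetI)
    fix f assume "f \<in> {f \<in> E. S \<subseteq> f}"
    then have f: "f \<in> E" "S \<subseteq> f" by auto
    show "f \<in> {S}"
      using card_subset_eq[OF edge_finite[OF f(1)] f(2)] 0 edge_card[OF f(1)] by simp
  qed
  then have "degree E S \<le> card {S}"
    unfolding degree_def by (intro card_mono) auto
  then show ?case using 0 by simp
next
  case (Suc k)
  then have "card S < n" by linarith
  then obtain e where e: "e \<in> E" "e \<inter> S = {}"
    using ex_disjoint_edge[OF Suc.prems(1)] by blast
  have "degree E S \<le> (\<Sum>v\<in>e. degree E (insert v S))"
    using edges_meet[OF e(1)] by (intro degree_le_sum finE edge_finite e) auto
  also have "\<dots> \<le> (\<Sum>v\<in>e. n ^ k)"
  proof (rule sum_mono)
    fix v assume "v \<in> e"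
    then have "v \<notin> S" using e by auto
    then have c: "card (insert v S) = Suc (card S)" using Suc.prems by simp
    have k: "k = n - card (insert v S)" using Suc.hyps(2) unfolding c by simp
    show "degree E (insert v S) \<le> n ^ k"
      using Suc.hyps(1)[OF k] Suc.prems Suc.hyps(2) c k by simp
  qed
  also have "\<dots> = n ^ (n - card S)"
    using Suc.hyps(2)[symmetric] edge_card[OF e(1)] by simp
  finally show ?case .
qed

text \<open>Normalised so that the bound \<open>degree_le\<close> becomes \<open>wdeg S \<le> 1\<close>.\<close>

definition wdeg :: "'a set \<Rightarrow> real" where
  "wdeg S = real (degree E S) * real n ^ card S / real n ^ n"

lemma degree_wdeg: "real (degree E S) = wdeg S * real n ^ n / real n ^ card S"
  using n_pos by (simp add: wdeg_def)

lemma wdeg_le_1: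
  assumes "finite S"
  shows "wdeg S \<le> 1"
proof (cases "card S \<le> n")
  case True
  have "real (degree E S) \<le> real (n ^ (n - card S))"
    using degree_le[OF assms True] by (simp only: of_nat_le_iff)
  then have "real (degree E S) * real n ^ card S \<le> real n ^ (n - card S) * real n ^ card S"
    by (intro mult_right_mono) auto
  also have "\<dots> = real n ^ n" using True by (simp flip: power_add)
  finally show ?thesis using n_pos by (simp add: wdeg_def)
next
  case False
  have "{f \<in> E. S \<subseteq> f} = {}"
    using False edge_card card_mono[OF edge_finite] by fastforce
  then have "degree E S = 0" unfolding degree_def by (simp only: card.empty)
  then show ?thesis by (simp add: wdeg_def)
qed

text \<open>An edge meeting both \<open>e\<close> and \<open>e'\<close> contains a vertex of \<open>e \<inter> e'\<close> or a vertex from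
  each of the two differences.\<close>

lemma wdeg_pair:
  assumes e: "e \<in> E" "e \<inter> S = {}" and e': "e' \<in> E" "e' \<inter> S = {}" and S: "finite S"
    and B1: "\<And>v. v \<in> e \<inter> e' \<Longrightarrow> wdeg (insert v S) \<le> B"
    and B2: "\<And>v w. v \<in> e - e' \<Longrightarrow> w \<in> e' - e \<Longrightarrow> wdeg (insert v (insert w S)) \<le> B"
    and x: "x = real (card (e \<inter> e')) / real n"
  shows "wdeg S \<le> (x + (1 - x)\<^sup>2) * B"
proof -
  \<comment> \<open>The factor between \<open>degree E S\<close> and \<open>wdeg S\<close>; each
    vertex added to \<open>S\<close> divides it by \<open>n\<close>.\<close>
  define N where "N = real n ^ n / real n ^ card S"
  have N: "N > 0" using n_pos by (simp add: N_def)
  note fin = edge_finite[OF e(1)] edge_finite[OF e'(1)]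
  define T where "T = (\<lambda>i. case i of Inl v \<Rightarrow> insert v S | Inr (v, w) \<Rightarrow> insert v (insert w S))"
  define I where "I = (e \<inter> e') <+> ((e - e') \<times> (e' - e))"
  have "degree E S \<le> (\<Sum>i\<in>I. degree E (T i))"
  proof (rule degree_le_sum[OF finE])
    show "finite I" using fin by (simp add: I_def)
    fix f assume f: "f \<in> E" "S \<subseteq> f"
    obtain v w where vw: "v \<in> e" "v \<in> f" "w \<in> e'" "w \<in> f"
      using edges_meet[OF e(1) f(1)] edges_meet[OF e'(1) f(1)] by auto
    consider "v \<in> e \<inter> e'" | "w \<in> e \<inter> e'" | "v \<in> e - e'" "w \<in> e' - e" using vw by blast
    then show "\<exists>i\<in>I. T i \<subseteq> f"
    proof cases
      case 1
      then show ?thesis using vw f by (intro bexI[of _ "Inl v"]) (auto simp: T_def I_def)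
    next
      case 2
      then show ?thesis using vw f by (intro bexI[of _ "Inl w"]) (auto simp: T_def I_def)
    next
      case 3
      then show ?thesis using vw f by (intro bexI[of _ "Inr (v, w)"]) (auto simp: T_def I_def)
    qed
  qed
  also have "\<dots> = (\<Sum>v\<in>e \<inter> e'. degree E (insert v S))
      + (\<Sum>(v, w)\<in>(e - e') \<times> (e' - e). degree E (insert v (insert w S)))"
    using fin by (simp add: I_def T_def sum.Plus case_prod_unfold)
  finally have "real (degree E S) \<le> (\<Sum>v\<in>e \<inter> e'. real (degree E (insert v S)))
      + (\<Sum>(v, w)\<in>(e - e') \<times> (e' - e). real (degree E (insert v (insert w S))))"
    by (simp add: case_prod_unfold flip: of_nat_sum of_nat_add)
  also have "\<dots> \<le> (\<Sum>v\<in>e \<inter> e'. B * N / n) + (\<Sum>(v, w)\<in>(e - e') \<times> (e' - e). B * N / n\<^sup>2)"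
  proof (intro add_mono sum_mono, goal_cases)
    case (1 v)
    then have "v \<notin> S" using e by auto
    then have "card (insert v S) = Suc (card S)" using S by simp
    then have "real (degree E (insert v S)) = wdeg (insert v S) * (N / n)"
      by (simp add: degree_wdeg N_def)
    also have "\<dots> \<le> B * (N / n)" using B1[OF 1] N by (intro mult_right_mono) auto
    finally show ?case by simp
  next
    case (2 p)
    then obtain v w where p: "p = (v, w)" "v \<in> e - e'" "w \<in> e' - e" by auto
    then have "v \<notin> S" "w \<notin> S" "v \<noteq> w" using e e' by auto
    then have "card (insert v (insert w S)) = Suc (Suc (card S))" using S by simp
    then have "real (degree E (insert v (insert w S))) = wdeg (insert v (insert w S)) * (N / n\<^sup>2)"
      by (simp add: degree_wdeg N_def power2_eq_square)
    also have "\<dots> \<le> B * (N / n\<^sup>2)" using B2[OF p(2,3)] N by (intro mult_right_mono) auto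
    finally show ?case using p by simp
  qed
  \<comment> \<open>There are \<open>x * n\<close> common vertices of weight \<open>1 / n\<close>,
    and \<open>(1 - x) * n\<close> choices on either side for the pairs, of weight
    \<open>1 / n\<^sup>2\<close>.\<close>
  also have "\<dots> = (x + (1 - x)\<^sup>2) * B * N"
  proof -
    have i: "card (e \<inter> e') \<le> n"
      using card_mono[OF fin(1), of "e \<inter> e'"] edge_card[OF e(1)] by auto
    have "card (e - e') = n - card (e \<inter> e')" "card (e' - e) = n - card (e \<inter> e')"
      using fin edge_card[OF e(1)] edge_card[OF e'(1)]
      by (simp_all add: card_Diff_subset_Int Int_commute)
    then have cards: "real (card (e - e')) = (1 - x) * n" "real (card (e' - e)) = (1 - x) * n"
      "real (card (e \<inter> e')) = x * n"
      using i n_pos by (simp_all add: x of_nat_diff field_simps)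
    have "(\<Sum>v\<in>e \<inter> e'. B * N / n) + (\<Sum>(v, w)\<in>(e - e') \<times> (e' - e). B * N / n\<^sup>2)
        = real (card (e \<inter> e')) * (B * N / n)
          + real (card (e - e')) * real (card (e' - e)) * (B * N / n\<^sup>2)"
      by (simp add: case_prod_unfold card_cartesian_product)
    then show ?thesis
      unfolding cards using n_pos by (simp add: field_simps power2_eq_square)
  qed
  finally have "wdeg S * N \<le> (x + (1 - x)\<^sup>2) * B * N" by (simp add: degree_wdeg N_def)
  then show ?thesis using N by simp
qed

text \<open>Each application of \<open>wdeg_pair\<close> may use up two vertices, hence the halved exponent.\<close>

lemma wdeg_decay:
  assumes pairs: "\<And>S. finite S \<Longrightarrow> card S \<le> K \<Longrightarrow>
      \<exists>e\<in>E. \<exists>e'\<in>E. e \<inter> S = {} \<and> e' \<inter> S = {} \<and>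
        y \<le> real (card (e \<inter> e')) / n \<and> real (card (e \<inter> e')) / n \<le> 1 - y"
    and y: "0 \<le> y" "y \<le> 1" and S: "finite S"
  shows "wdeg S \<le> (1 - y * (1 - y)) ^ ((K + 2 - card S) div 2)"
  using S
proof (induction "K + 2 - card S" arbitrary: S rule: less_induct)
  case less
  define \<rho> where "\<rho> = 1 - y * (1 - y)"
  have y1: "y * (1 - y) \<le> 1" using y by (simp add: mult_le_one)
  have y2: "y * (1 - y) \<ge> 0" using y by simp
  have \<rho>: "0 \<le> \<rho>" "\<rho> \<le> 1" unfolding \<rho>_def using y1 y2 by simp_all
  show ?case
  proof (cases "card S \<le> K")
    case False
    then have "(K + 2 - card S) div 2 = 0" by auto
    then show ?thesis using wdeg_le_1[OF less.prems] by simp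
  next
    case True
    obtain e e' where e: "e \<in> E" "e \<inter> S = {}" and e': "e' \<in> E" "e' \<inter> S = {}"
      and x: "y \<le> real (card (e \<inter> e')) / n" "real (card (e \<inter> e')) / n \<le> 1 - y"
      using pairs[OF less.prems True] by blast
    define x where "x = real (card (e \<inter> e')) / n"
    \<comment> \<open>The inductive bound for two added vertices. It also covers one added vertex,
      where the exponent is at least as large and \<open>\<rho> \<le> 1\<close>.\<close>
    define B where "B = \<rho> ^ ((K - card S) div 2)"
    have "wdeg S \<le> (x + (1 - x)\<^sup>2) * B"
    proof (rule wdeg_pair[OF e e' less.prems _ _ x_def])
      fix v assume "v \<in> e \<inter> e'"
      then have "v \<notin> S" using e by auto
      then have c: "card (insert v S) = Suc (card S)" using less.prems by simp
      have "wdeg (insert v S) \<le> \<rho> ^ ((K + 2 - card (insert v S)) div 2)"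
        unfolding \<rho>_def using less.prems True by (intro less.hyps) (auto simp: c)
      also have "\<dots> \<le> B"
        unfolding B_def c using \<rho> by (intro power_decreasing) auto
      finally show "wdeg (insert v S) \<le> B" .
    next
      fix v w assume "v \<in> e - e'" "w \<in> e' - e"
      then have "v \<notin> S" "w \<notin> S" "v \<noteq> w" using e e' by auto
      then have c: "card (insert v (insert w S)) = Suc (Suc (card S))" using less.prems by simp
      have "wdeg (insert v (insert w S)) \<le> \<rho> ^ ((K + 2 - card (insert v (insert w S))) div 2)"
        unfolding \<rho>_def using less.prems True by (intro less.hyps) (auto simp: c)
      also have "\<dots> = B" unfolding B_def c by simp
      finally show "wdeg (insert v (insert w S)) \<le> B" .
    qed
    also have "\<dots> \<le> \<rho> * B"
    proof (rule mult_right_mono)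
      \<comment> \<open>The product equals \<open>x * (1 - x) - y * (1 - y)\<close>, while
        \<open>x + (1 - x)\<^sup>2 = 1 - x * (1 - x)\<close>.\<close>
      have "0 \<le> (x - y) * (1 - x - y)" using x by (intro mult_nonneg_nonneg) (auto simp: x_def)
      then show "x + (1 - x)\<^sup>2 \<le> \<rho>"
        unfolding \<rho>_def by (simp add: power2_eq_square algebra_simps)
      show "0 \<le> B" using \<rho> by (simp add: B_def)
    qed
    also have "\<dots> = \<rho> ^ ((K + 2 - card S) div 2)"
    proof -
      have "(K + 2 - card S) div 2 = Suc ((K - card S) div 2)" using True by linarith
      then show ?thesis by (simp add: B_def)
    qed
    finally show ?thesis unfolding \<rho>_def .
  qed
qed

text \<open>Otherwise any two distinct edges of \<open>F\<close> meet in a number of vertices from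
  \<open>L\<close>: at least one by the clique property, fewer than \<open>n\<close> since both have
  size \<open>n\<close>. As \<open>n\<close> is not in \<open>L\<close>,
  \<open>frankl_wilson\<close> applies.\<close>

lemma ex_pair:
  assumes m: "2 \<le> m" "2 * m \<le> n" and V_le: "card V \<le> n ^ m"
    and F: "F \<subseteq> E" "card F > A n m"
  shows "\<exists>e\<in>F. \<exists>e'\<in>F. q n m < card (e \<inter> e') \<and> card (e \<inter> e') < n - q n m"
proof (rule ccontr)
  assume no: "\<not> ?thesis"
  define L where "L = {1..q n m} \<union> {n - q n m..<n}"
  \<comment> \<open>This makes the two blocks of \<open>L\<close> disjoint and keeps their lengths
    equal to \<open>q n m\<close>.\<close>
  have qn: "2 * q n m < n"
  proof -
    have "4 * q n m \<le> 2 * m * q n m" using m by (intro mult_right_mono) auto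
    then show ?thesis using q_bounds(1)[of m n] m n_pos by linarith
  qed
  have "card L = 2 * q n m"
    unfolding L_def using qn by (subst card_Un_disjoint) auto
  have "card F \<le> (\<Sum>i = 0..card L. card V choose i)"
  proof (rule frankl_wilson[OF finV])
    show "F \<subseteq> Pow V" using F edge_subset by auto
    show "finite L" by (simp add: L_def)
    show "card e \<notin> L" if "e \<in> F" for e
      using that F edge_card[of e] qn by (auto simp: L_def)
    fix e f assume ef: "e \<in> F" "f \<in> F" "e \<noteq> f"
    then have E: "e \<in> E" "f \<in> E" using F by auto
    have "card (e \<inter> f) > 0"
      using edges_meet[OF E] edge_finite[OF E(1)] by (auto simp: card_gt_0_iff)
    moreover have "card (e \<inter> f) < n"
    proof -
      have "e \<inter> f \<noteq> e"
        using card_subset_eq[OF edge_finite[OF E(2)], of e] edge_card E ef by auto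
      then have "e \<inter> f \<subset> e" by auto
      then show ?thesis using psubset_card_mono[OF edge_finite[OF E(1)]] edge_card E by metis
    qed
    ultimately show "card (e \<inter> f) \<in> L" using no ef by (auto simp: L_def not_less)
  qed
  also have "\<dots> \<le> A n m"
    unfolding A_def \<open>card L = 2 * q n m\<close>
    by (intro sum_mono binomial_right_mono V_le)
  finally show False using F by simp
qed

section \<open>The bound on the number of edges\<close>

theorem card_edges_le:
  assumes n: "4 \<le> n" and m: "2 \<le> m" "2 * m \<le> n" and V_le: "card V \<le> n ^ m"
  shows "card E \<le> 4 * m * n ^ (n - 1) + A n m"
proof (rule ccontr)
  assume "\<not> ?thesis"
  then have big: "card E > 4 * m * n ^ (n - 1) + A n m" by simp
  then have "E \<noteq> {}" by auto
  then obtain e0 where e0: "e0 \<in> E" by auto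
  then have "e0 \<noteq> {}" using edge_card n by fastforce
  then have Vne: "V \<noteq> {}" using e0 edge_subset by auto
  define D where "D = Max ((\<lambda>v. degree E {v}) ` V)"
  have D_max: "degree E {v} \<le> D" if "v \<in> V" for v
    unfolding D_def using that finV by (intro Max_ge) auto
  have "D \<in> (\<lambda>v. degree E {v}) ` V"
    unfolding D_def using finV Vne by (intro Max_in) auto
  then obtain v0 where v0: "D = degree E {v0}" by auto
  have "D > 0"
  proof -
    obtain v where v: "v \<in> e0" using \<open>e0 \<noteq> {}\<close> by auto
    have "degree E {v} > 0" unfolding degree_def
      using finE e0 v by (auto simp: card_gt_0_iff)
    then show ?thesis using D_max[of v] v e0 edge_subset by fastforce
  qed
  define x where "x = wdeg {v0}"
  have pow: "real n ^ n = real n * real n ^ (n - 1)" using n_pos by (cases n) auto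
  have x_D: "real D = x * real n ^ (n - 1)"
    unfolding x_def wdeg_def v0 pow using n_pos by simp
  have x_pos: "x > 0" using \<open>D > 0\<close> n_pos by (simp add: x_def wdeg_def v0)
  have x1: "x \<le> 1" unfolding x_def by (intro wdeg_le_1) simp
  \<comment> \<open>The largest \<open>K\<close> for which \<open>K\<close> vertices of degree at
    most \<open>D\<close> are guaranteed to meet no more than \<open>4 * m * n ^ (n - 1)\<close>
    edges, the assumed surplus over \<open>A n m\<close>.\<close>
  define K where "K = nat \<lfloor>4 * real m / x\<rfloor>"
  have K: "real K \<le> 4 * m / x" "4 * m / x < real K + 1"
    unfolding K_def using x_pos by (simp_all add: floor_less_cancel)
  define y where "y = 1 / (2 * real m)"
  have y: "0 \<le> y" "y \<le> 1 / 4" using m by (simp_all add: y_def field_simps)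
  have "\<exists>e\<in>E. \<exists>e'\<in>E. e \<inter> S = {} \<and> e' \<inter> S = {} \<and>
        y \<le> real (card (e \<inter> e')) / n \<and> real (card (e \<inter> e')) / n \<le> 1 - y"
    if S: "finite S" "card S \<le> K" for S
  proof -
    define F where "F = {f \<in> E. f \<inter> S = {}}"
    have "E - F \<subseteq> (\<Union>v\<in>S \<inter> V. {f \<in> E. {v} \<subseteq> f})"
      using edge_subset by (auto simp: F_def)
    then have "card (E - F) \<le> card (\<Union>v\<in>S \<inter> V. {f \<in> E. {v} \<subseteq> f})"
      using finE S by (intro card_mono) auto
    also have "\<dots> \<le> (\<Sum>v\<in>S \<inter> V. degree E {v})"
      unfolding degree_def using S by (intro card_UN_le) auto
    also have "\<dots> \<le> (\<Sum>v\<in>S \<inter> V. D)" by (intro sum_mono D_max) auto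
    also have "\<dots> \<le> card S * D" using S by (simp add: card_mono)
    also have "\<dots> \<le> K * D" using S by simp
    also have "K * D \<le> 4 * m * n ^ (n - 1)"
    proof -
      have "real K * real D \<le> 4 * m / x * (x * real n ^ (n - 1))"
        unfolding x_D using K x_pos by (intro mult_right_mono) auto
      also have "\<dots> = real (4 * m * n ^ (n - 1))" using x_pos by simp
      finally show ?thesis by (simp only: of_nat_le_iff flip: of_nat_mult)
    qed
    finally have "card (E - F) \<le> 4 * m * n ^ (n - 1)" .
    moreover have "card E = card F + card (E - F)"
      using finE by (subst card_Un_disjoint[symmetric]) (auto simp: F_def intro: arg_cong[where f = card])
    ultimately have "card F > A n m" using big by simp
    then obtain e e' where e: "e \<in> F" "e' \<in> F" "q n m < card (e \<inter> e')" "card (e \<inter> e') < n - q n m"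
      using ex_pair[OF m V_le, of F] by (auto simp: F_def)
    have "real n < 2 * real m * (real (q n m) + 1)" using q_bounds(2) m by simp
    then have qy: "y * n \<le> real (q n m) + 1"
      using m by (simp add: y_def field_simps)
    \<comment> \<open>Strict inequalities between integers gain the 1 that makes up for the floor in
      \<open>q\<close>.\<close>
    have "y * n \<le> real (card (e \<inter> e'))" using qy e(3) by linarith
    moreover have "real (card (e \<inter> e')) \<le> n - y * n" using qy e(4) by linarith
    ultimately have "y \<le> real (card (e \<inter> e')) / n" "real (card (e \<inter> e')) / n \<le> 1 - y"
      using n_pos by (simp_all add: field_simps)
    then show ?thesis
      using e(1,2) unfolding F_def by blast
  qed
  then have "x \<le> (1 - y * (1 - y)) ^ ((K + 2 - card {v0}) div 2)"
    unfolding x_def using y by (intro wdeg_decay) auto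
  also have "\<dots> \<le> exp (- (y * (1 - y))) ^ ((K + 2 - card {v0}) div 2)"
  proof (rule power_mono)
    show "1 - y * (1 - y) \<le> exp (- (y * (1 - y)))"
      using exp_ge_add_one_self[of "- (y * (1 - y))"] by simp
    show "0 \<le> 1 - y * (1 - y)" using y by (simp add: mult_le_one)
  qed
  \<comment> \<open>The decay starts at a single vertex, so \<open>K + 2 - card {v0}\<close> is
    \<open>K + 1\<close>.\<close>
  also have "\<dots> = exp (- (y * (1 - y) * ((K + 1) div 2)))"
    by (simp add: exp_of_nat_mult[symmetric] mult.commute)
  finally have "ln x \<le> ln (exp (- (y * (1 - y) * ((K + 1) div 2))))"
    using x_pos by (simp only: ln_le_cancel_iff exp_gt_zero)
  then have "ln x \<le> - (y * (1 - y) * ((K + 1) div 2))"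
    by (simp only: ln_exp)
  \<comment> \<open>Since \<open>4 * m / x \<ge> 8\<close>, the floor in \<open>K\<close> loses at
    most an eighth; with \<open>1 - y \<ge> 3 / 4\<close> and \<open>y = 1 / (2 * m)\<close> the
    constant is \<open>21 / 32\<close>, above \<open>1 / 2\<close>.\<close>
  moreover have "y * (1 - y) * ((K + 1) div 2) > 1 / (2 * x)"
  proof -
    have half: "real ((K + 1) div 2) \<ge> real K / 2" by linarith
    have "real K \<ge> 7 / 8 * (4 * m / x)"
    proof -
      have "4 * m / x \<ge> 8" using m x1 x_pos by (simp add: field_simps)
      then show ?thesis using K(2) by linarith
    qed
    then have "real ((K + 1) div 2) \<ge> 7 / 4 * (m / x)" using half by linarith
    moreover have "y * (1 - y) \<ge> y * (3 / 4)" using y by (intro mult_left_mono) auto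
    ultimately have "y * (1 - y) * ((K + 1) div 2) \<ge> y * (3 / 4) * (7 / 4 * (m / x))"
      using y x_pos by (intro mult_mono) auto
    also have "y * (3 / 4) * (7 / 4 * (m / x)) = 21 / 32 / x"
      using m by (simp add: y_def)
    finally show ?thesis using x_pos by (auto simp: field_simps)
  qed
  \<comment> \<open>Splitting off \<open>ln 2 < 1\<close> absorbs the constant in
    \<open>ln t \<le> t - 1\<close> at \<open>t = 1 / (2 * x)\<close>. This contradicts the decay
    estimate.\<close>
  moreover have "ln (1 / x) \<le> 1 / (2 * x)"
  proof -
    have "ln (1 / (2 * x)) \<le> 1 / (2 * x) - 1" using x_pos by (intro ln_le_minus_one) simp
    moreover have "ln (1 / x) = ln 2 + ln (1 / (2 * x))"
      using x_pos by (simp add: ln_div ln_mult)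
    ultimately show ?thesis using ln_2_less_1 by linarith
  qed
  ultimately show False using x_pos by (simp add: ln_div)
qed

end

section \<open>The size of \<open>A\<close>\<close>

lemma sum_binomial_le:
  assumes "2 * s \<le> N"
  shows "real (\<Sum>i = 0..s. N choose i) \<le> 2 * real N ^ s / fact s"
  using assms
proof (induction s)
  case (Suc s)
  have "real (N choose Suc s) * fact (Suc s) \<le> real N ^ Suc s"
    using binomial_fact_pow[of N "Suc s"]
    by (metis of_nat_fact of_nat_le_iff of_nat_mult of_nat_power)
  then have "real (N choose Suc s) \<le> real N ^ Suc s / fact (Suc s)"
    by (simp add: field_simps del: fact_Suc)
  \<comment> \<open>The ratio of consecutive terms \<open>N ^ s / fact s\<close> is
    \<open>N / Suc s \<ge> 2\<close>, so twice the old term fits into one copy of the new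
    one.\<close>
  moreover have "2 * real N ^ s / fact s \<le> real N ^ Suc s / fact (Suc s)"
  proof -
    have "2 * real (Suc s) * real N ^ s \<le> real N * real N ^ s"
      using Suc.prems by (intro mult_right_mono) auto
    then have "2 * real N ^ s / fact s \<le> (real N * real N ^ s / Suc s) / fact s"
      by (intro divide_right_mono) (simp_all add: field_simps)
    then show ?thesis by (simp add: field_simps)
  qed
  moreover have "real (\<Sum>i = 0..s. N choose i) \<le> 2 * real N ^ s / fact s"
    using Suc by simp
  moreover have "real (\<Sum>i = 0..Suc s. N choose i)
      = real (\<Sum>i = 0..s. N choose i) + real (N choose Suc s)"
    by simp
  moreover have "2 * real N ^ Suc s / fact (Suc s) = 2 * (real N ^ Suc s / fact (Suc s))"
    by simp
  ultimately show ?case by linarith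
qed simp

text \<open>A quadratic lower bound on the factorial is enough: it supplies the factor of order
  \<open>(m / n)\<^sup>2\<close> in \<open>A_le\<close>.\<close>

lemma Suc_sq_le_fact: "real (k + 1) ^ 2 \<le> 2 * fact (2 * k)"
proof (cases k)
  case (Suc j)
  have f: "fact (2 * k) = (2 * k) * ((2 * k - 1) * fact (2 * j))"
    unfolding Suc by (simp add: fact_reduce)
  have "(k + 1)\<^sup>2 \<le> 2 * ((2 * k) * ((2 * k - 1) * 1))"
    unfolding Suc by (simp add: power2_eq_square algebra_simps)
  also have "\<dots> \<le> 2 * fact (2 * k)" unfolding f by (intro mult_left_mono fact_ge_1) auto
  finally have "real ((k + 1)\<^sup>2) \<le> real (2 * fact (2 * k))" by (simp only: of_nat_le_iff)
  then show ?thesis by simp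
qed simp

text \<open>The power of \<open>n ^ m\<close> is at most \<open>n ^ n\<close>, one factor
  \<open>n\<close> too many. The factorial is at least \<open>(n / (2 * m))\<^sup>2 / 2\<close>,
  which compensates for it and leaves the small factor \<open>m / n\<close>.\<close>

lemma A_le:
  assumes m: "2 \<le> m" "2 * m \<le> n"
  shows "real (A n m) \<le> 16 * (real m / real n) * (real m * real n ^ (n - 1))"
proof -
  define k where "k = q n m"
  have n: "n > 0" using m by simp
  have q1: "2 * m * k \<le> n" and q2: "real n < 2 * real m * (real k + 1)"
    using q_bounds[of m n] m by (auto simp: k_def)
  have "2 * (2 * k) \<le> n ^ m"
  proof -
    have "4 * k \<le> 2 * m * k" using m by (intro mult_right_mono) auto
    also have "\<dots> \<le> n ^ 1" using q1 by simp
    also have "\<dots> \<le> n ^ m" using m by (intro power_increasing) auto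
    finally show ?thesis by simp
  qed
  then have "real (A n m) \<le> 2 * real (n ^ m) ^ (2 * k) / fact (2 * k)"
    unfolding A_def k_def[symmetric] by (rule sum_binomial_le)
  also have "real (n ^ m) ^ (2 * k) \<le> real n ^ n"
    using q1 n by (auto simp: power_mult[symmetric] mult_ac intro!: power_increasing)
  also have "2 * real n ^ n / fact (2 * k) \<le> 2 * real n ^ n / ((real k + 1)\<^sup>2 / 2)"
    using Suc_sq_le_fact[of k] by (intro divide_left_mono) (auto simp: add_ac)
  also have "\<dots> \<le> 2 * real n ^ n / ((real n / (2 * m))\<^sup>2 / 2)"
  proof (intro divide_left_mono divide_right_mono power_mono mult_pos_pos)
    show "real n / (2 * m) \<le> real k + 1" using q2 m by (simp add: field_simps)
  qed (use n m in auto)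
  also have "\<dots> = 16 * (real m / real n) * (real m * real n ^ (n - 1))"
  proof -
    have "real n ^ n = real n * real n ^ (n - 1)" using n by (cases n) auto
    then show ?thesis using n m by (simp add: field_simps power2_eq_square)
  qed
  finally show ?thesis by (simp add: divide_right_mono)
qed

section \<open>The edge bound and its asymptotics combined\<close>

theorem theorem3:
  fixes m :: "nat \<Rightarrow> nat"
  assumes m_ge: "\<And>n. n \<ge> 4 \<Longrightarrow> 2 \<le> m n"
    and m_le: "\<And>n. n \<ge> 4 \<Longrightarrow> real (m n) \<le> real n / 2"
    and m_small: "(\<lambda>n. real (m n)) \<in> o[at_top](\<lambda>n. real n)"
  shows "(\<forall>n\<ge>4. \<forall>(V :: 'a set) (E :: 'a set set).
            hypergraph V E \<and> uniform n E \<and> clique E \<and> chromatic_number V E = 3 \<and>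
            finite V \<and> card V \<le> n ^ m n \<longrightarrow>
            card E \<le> 4 * m n * n ^ (n - 1) + A n (m n))
       \<and> (\<exists>\<epsilon> :: nat \<Rightarrow> real. \<epsilon> \<longlonglongrightarrow> 0 \<and>
            (\<forall>n\<ge>4. real (4 * m n * n ^ (n - 1) + A n (m n))
                   = (4 + \<epsilon> n) * real (m n) * real n ^ (n - 1)))"
proof (intro conjI allI impI)
  fix n :: nat and V :: "'a set" and E :: "'a set set"
  assume n: "4 \<le> n" and H: "hypergraph V E \<and> uniform n E \<and> clique E \<and> chromatic_number V E = 3 \<and>
            finite V \<and> card V \<le> n ^ m n"
  then interpret three_chromatic_clique V E n by unfold_locales auto
  show "card E \<le> 4 * m n * n ^ (n - 1) + A n (m n)"
    using card_edges_le[OF n m_ge[OF n]] m_le[OF n] H by simp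
next
  \<comment> \<open>The error term forced by the required identity; \<open>A_le\<close> bounds it by
    a multiple of \<open>m n / n\<close>, which tends to 0.\<close>
  define \<epsilon> where "\<epsilon> n = real (A n (m n)) / (real (m n) * real n ^ (n - 1))" for n
  have eps_le: "\<epsilon> n \<le> 16 * (real (m n) / real n)" if n: "n \<ge> 4" for n
  proof -
    have "2 * m n \<le> n" using m_le[OF n] by simp
    moreover have "real (m n) * real n ^ (n - 1) > 0" using m_ge[OF n] n by simp
    ultimately show ?thesis
      using A_le[OF m_ge[OF n]] by (simp only: \<epsilon>_def pos_divide_le_eq)
  qed
  have "\<epsilon> \<longlonglongrightarrow> 0"
  proof (rule tendsto_sandwich)
    show "eventually (\<lambda>n. 0 \<le> \<epsilon> n) sequentially" by (simp add: \<epsilon>_def)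
    show "eventually (\<lambda>n. \<epsilon> n \<le> 16 * (real (m n) / real n)) sequentially"
      using eps_le by (auto simp: eventually_at_top_linorder)
    show "(\<lambda>n. 16 * (real (m n) / real n)) \<longlonglongrightarrow> 0"
      using tendsto_mult_left[OF smalloD_tendsto[OF m_small], of 16] by simp
  qed simp
  moreover have "real (4 * m n * n ^ (n - 1) + A n (m n))
      = (4 + \<epsilon> n) * real (m n) * real n ^ (n - 1)" if n: "n \<ge> 4" for n
    using m_ge[OF n] n by (simp add: \<epsilon>_def field_simps)
  ultimately show "\<exists>\<epsilon> :: nat \<Rightarrow> real. \<epsilon> \<longlonglongrightarrow> 0 \<and>
      (\<forall>n\<ge>4. real (4 * m n * n ^ (n - 1) + A n (m n))
             = (4 + \<epsilon> n) * real (m n) * real n ^ (n - 1))"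
    by blast
qed

end
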